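(* Let $I\subseteq(0,\infty)$ be an interval, let $f:I\to\mathbb{R}$ be differentiable on the interior $I^{\circ}$ of $I$, let $a,b\in I$ with $a<b$, let $g:[a,b]\to[0,\infty)$ be a continuous positive function that is geometrically symmetric with respect to $\sqrt{ab}$, and let $h:[a,b]\to[0,\infty)$ be differentiable. Let $p,q>1$ with $\frac1q+\frac1p=1$, and put $G=\sqrt{ab}$. If $|f'|^q$ is GA-convex on $[a,b]$, then $$\left|\left[h(b)-2h(a)\right]\frac{f(a)}{2}+h(b)\frac{f(b)}{2}-\int_a^b f(x)h'(x)\,dx\right|$$ $$\le\frac{\ln b-\ln a}{4}\Bigg\{\left(\int_0^1\left|2h(a^tG^{1-t})-h(b)\right|dt\right)^{1-\frac1q}\left(\int_0^1\left|2h(a^tG^{1-t})-h(b)\right|\left(t\,a^{qt}G^{q(1-t)}|f'(a)|^q+(1-t)a^{qt}G^{q(1-t)}|f'(G)|^q\right)dt\right)^{\frac1q}$$ $$+\left(\int_0^1\left|2h(b^tG^{1-t})-h(b)\right|dt\right)^{1-\frac1q}\left(\int_0^1\left|2h(b^tG^{1-t})-h(b)\right|\left(t\,b^{qt}G^{q(1-t)}|f'(b)|^q+(1-t)b^{qt}G^{q(1-t)}|f'(G)|^q\right)dt\right)^{\frac1q}\Bigg\}.$$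
   Context: A function $\varphi:J\to\mathbb{R}$ on an interval $J\subseteq(0,\infty)$ is GA-convex on $J$ if $\varphi(x^{\lambda}y^{1-\lambda})\le\lambda\varphi(x)+(1-\lambda)\varphi(y)$ for all $x,y\in J$ and $\lambda\in[0,1]$. A function $g$ on $[a,b]$ is geometrically symmetric with respect to $\sqrt{ab}$ if $g(ab/x)=g(x)$ for all $x\in[a,b]$. *)

theory Defs
  imports "HOL-Analysis.Analysis"
begin

definition GA_convex_on :: "real set \<Rightarrow> (real \<Rightarrow> real) \<Rightarrow> bool" where
  "GA_convex_on J \<phi> \<longleftrightarrow>
     is_interval J \<and> J \<subseteq> {0<..} \<and>
     (\<forall>x\<in>J. \<forall>y\<in>J. \<forall>l\<in>{0..1}.
        \<phi> (x powr l * y powr (1 - l)) \<le> l * \<phi> x + (1 - l) * \<phi> y)"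

definition geometrically_symmetric :: "real \<Rightarrow> real \<Rightarrow> (real \<Rightarrow> real) \<Rightarrow> bool" where
  "geometrically_symmetric a b g \<longleftrightarrow> (\<forall>x\<in>{a..b}. g (a * b / x) = g x)"

end

theory Submission
  imports Defs
begin

text \<open>
  Integrating \<open>(2 h - h b) f'\<close> by parts over \<open>{a..b}\<close> gives twice the quantity to be estimated. The
  integral is split at the geometric mean \<open>G\<close>, and each half is parametrised by a geometric path
  \<open>c\<^sup>t G\<^sup>1\<^sup>-\<^sup>t\<close>; a power mean inequality and GA-convexity along the path bound the two halves.
  Since \<open>h'\<close> is an arbitrary derivative, integrability has to come from elsewhere: GA-convexity bounds
  \<open>f'\<close>, hence \<open>(2 h - h b) f'\<close> is absolutely integrable, and then so is \<open>f h'\<close> in the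
  Henstock-Kurzweil sense.
\<close>

section \<open>Weighted power means\<close>

text \<open>Young's inequality for \<open>v\<close> and \<open>u powr (q - 1)\<close>, multiplied by
  \<open>q\<close>, puts the convex power function above its tangent at \<open>u\<close>. No
  derivative is taken, so \<open>v = 0\<close> needs no separate case.\<close>

lemma powr_tangent_le:
  fixes q u v :: real
  assumes "q > 1" and "u > 0" and "v \<ge> 0"
  shows "u powr q + q * u powr (q - 1) * (v - u) \<le> v powr q"
proof -
  define p where "p = q / (q - 1)"
  have p: "p > 1" "1 / q + 1 / p = 1" "(q - 1) * p = q"
    using assms by (auto simp: p_def field_simps)
  have "v * u powr (q - 1) \<le> v powr q / q + (u powr (q - 1)) powr p / p"
    using Youngs_inequality[of q p v "u powr (q - 1)"] p assms by simp
  also have "(u powr (q - 1)) powr p = u powr q"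
    by (simp add: powr_powr p)
  finally have "v * u powr (q - 1) \<le> v powr q / q + u powr q / p" .
  then have "q * (v * u powr (q - 1)) \<le> q * (v powr q / q + u powr q / p)"
    using assms by (intro mult_left_mono) auto
  also have "\<dots> = v powr q + (q - 1) * u powr q"
    using assms by (simp add: p_def field_simps)
  finally have "q * v * u powr (q - 1) \<le> v powr q + (q - 1) * u powr q"
    by (simp add: mult.assoc)
  moreover have "u * u powr (q - 1) = u powr q"
    using assms by (simp add: powr_diff)
  ultimately show ?thesis
    by (simp add: algebra_simps)
qed

text \<open>
  The weighted power mean inequality, with \<open>v\<^sup>q\<close> replaced by an integrable majorant so that \<open>v\<^sup>q\<close>
  itself need not be integrable.
\<close>

lemma integral_power_mean_le:
  fixes w v V :: "real \<Rightarrow> real" and q :: real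
  assumes q: "q > 1" and ab: "a < b"
    and w: "continuous_on {a..b} w" "\<And>t. t \<in> {a..b} \<Longrightarrow> w t \<ge> 0"
    and wv: "(\<lambda>t. w t * v t) integrable_on {a..b}"
    and v: "\<And>t. t \<in> {a..b} \<Longrightarrow> v t \<ge> 0"
    and wV: "(\<lambda>t. w t * V t) integrable_on {a..b}"
    and le: "\<And>t. t \<in> {a..b} \<Longrightarrow> v t powr q \<le> V t"
  shows "integral {a..b} (\<lambda>t. w t * v t)
    \<le> integral {a..b} w powr (1 - 1 / q) * integral {a..b} (\<lambda>t. w t * V t) powr (1 / q)"
proof -
  define A where "A = integral {a..b} w"
  define B where "B = integral {a..b} (\<lambda>t. w t * V t)"
  define C where "C = integral {a..b} (\<lambda>t. w t * v t)"
  have wi: "w integrable_on {a..b}"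
    using w(1) by (rule integrable_continuous_real)
  have A0: "A \<ge> 0"
    unfolding A_def using wi w(2) by (rule integral_nonneg)
  have C0: "C \<ge> 0"
    unfolding C_def using wv w(2) v by (intro integral_nonneg) auto
  show ?thesis
  proof (cases "C = 0")
    case True
    then show ?thesis by (simp add: C_def)
  next
    case False
    with C0 have C: "C > 0" by simp
    \<comment> \<open>A continuous nonnegative weight with zero integral vanishes identically, which
      would force \<open>C = 0\<close>.\<close>
    have A: "A > 0"
    proof (rule ccontr)
      assume "\<not> A > 0"
      with A0 have "A = 0" by simp
      then have "\<forall>t\<in>{a..b}. w t = 0"
        using integral_eq_0_iff[OF w(1) ab w(2)] by (simp add: A_def)
      then have "C = integral {a..b} (\<lambda>t. 0)"
        unfolding C_def by (intro integral_cong) auto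
      with C show False by simp
    qed
    \<comment> \<open>\<open>u\<close> is the \<open>w\<close>-weighted mean of \<open>v\<close>.
      With the tangent taken at the mean, the linear term \<open>k * (C - u * A)\<close> vanishes
      after integration.\<close>
    define u where "u = C / A"
    have u: "u > 0" using A C by (simp add: u_def)
    define k where "k = q * u powr (q - 1)"
    have "((\<lambda>t. (u powr q - k * u) * w t + k * (w t * v t)) has_integral
        (u powr q - k * u) * A + k * C) {a..b}"
      unfolding A_def C_def
      by (intro has_integral_add has_integral_mult_right integrable_integral wi wv)
    moreover have "((\<lambda>t. w t * V t) has_integral B) {a..b}"
      unfolding B_def using wV by (rule integrable_integral)
    moreover have "(u powr q - k * u) * w t + k * (w t * v t) \<le> w t * V t" if t: "t \<in> {a..b}" for t
    proof -
      have "u powr q + k * (v t - u) \<le> V t"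
        using powr_tangent_le[OF q u v[OF t]] le[OF t] by (simp add: k_def)
      then have "w t * (u powr q + k * (v t - u)) \<le> w t * V t"
        using w(2)[OF t] by (rule mult_left_mono)
      then show ?thesis by (simp add: algebra_simps)
    qed
    ultimately have "(u powr q - k * u) * A + k * C \<le> B"
      by (rule has_integral_le)
    moreover have "(u powr q - k * u) * A + k * C = u powr q * A"
      using A by (simp add: u_def algebra_simps)
    ultimately have uB: "u powr q * A \<le> B" by simp
    \<comment> \<open>Factoring \<open>u * A\<close> as below isolates \<open>u powr q * A\<close>,
      the quantity that \<open>uB\<close> bounds by \<open>B\<close>.\<close>
    have "C = u * A" using A by (simp add: u_def)
    also have "\<dots> = A powr (1 - 1 / q) * (u powr q * A) powr (1 / q)"
    proof -
      have "(u powr q * A) powr (1 / q) = u * A powr (1 / q)"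
        using u A q by (simp add: powr_mult powr_powr)
      moreover have "A powr (1 - 1 / q) * A powr (1 / q) = A"
        using A by (simp flip: powr_add)
      ultimately show ?thesis by (simp add: algebra_simps)
    qed
    also have "\<dots> \<le> A powr (1 - 1 / q) * B powr (1 / q)"
      using uB A u q by (intro mult_left_mono powr_mono2) auto
    finally show ?thesis by (simp add: A_def B_def C_def)
  qed
qed

section \<open>Geometric paths between positive reals\<close>

text \<open>In logarithmic coordinates the path is the affine segment from \<open>ln d\<close> to
  \<open>ln c\<close>, and \<open>exp\<close> maps it monotonically back. Writing the image as
  \<open>closed_segment\<close> covers both orders of \<open>c\<close> and \<open>d\<close>.\<close>

lemma geometric_path_image:
  fixes c d :: real
  assumes "c > 0" and "d > 0" and "c \<noteq> d"
  shows "(\<lambda>t. c powr t * d powr (1 - t)) ` {0..1} = closed_segment c d"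
proof -
  have path: "c powr t * d powr (1 - t) = exp ((1 - t) *\<^sub>R ln d + t *\<^sub>R ln c)" for t
    using assms by (simp add: powr_def exp_add mult.commute)
  have "(\<lambda>t. c powr t * d powr (1 - t)) ` {0..1} = exp ` closed_segment (ln d) (ln c)"
    unfolding path closed_segment_def by force
  also have "\<dots> = closed_segment d c"
  proof (intro equalityI subsetI)
    fix y assume "y \<in> exp ` closed_segment (ln d) (ln c)"
    then obtain z where "y = exp z" "z \<in> closed_segment (ln d) (ln c)" by blast
    then show "y \<in> closed_segment d c"
      using assms by (auto simp: closed_segment_eq_real_ivl ln_ge_iff split: if_splits)
        (metis exp_le_cancel_iff exp_ln)+
  next
    fix y assume y: "y \<in> closed_segment d c"
    then have "y > 0" using assms by (auto simp: closed_segment_eq_real_ivl split: if_splits)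
    with y have "ln y \<in> closed_segment (ln d) (ln c)" "y = exp (ln y)"
      using assms by (auto simp: closed_segment_eq_real_ivl split: if_splits)
    then show "y \<in> exp ` closed_segment (ln d) (ln c)" by blast
  qed
  finally show ?thesis by (simp add: closed_segment_commute)
qed

lemma geometric_path_inj:
  fixes c d :: real
  assumes "c > 0" and "d > 0" and "c \<noteq> d"
  shows "inj (\<lambda>t. c powr t * d powr (1 - t))"
proof (rule injI)
  fix s t assume "c powr s * d powr (1 - s) = c powr t * d powr (1 - t)"
  then have "ln (c powr s * d powr (1 - s)) = ln (c powr t * d powr (1 - t))" by simp
  then have "(s - t) * (ln c - ln d) = 0"
    using assms by (simp add: ln_mult ln_powr algebra_simps)
  then show "s = t" using assms by simp
qed

lemma geometric_path_has_derivative: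
  fixes c d :: real
  assumes "c > 0" and "d > 0"
  shows "((\<lambda>t. c powr t * d powr (1 - t)) has_real_derivative
    (ln c - ln d) * (c powr t * d powr (1 - t))) (at t within S)"
proof -
  have "(\<lambda>t. c powr t * d powr (1 - t)) = (\<lambda>t. exp (t * ln c + (1 - t) * ln d))"
    using assms by (simp add: powr_def exp_add)
  moreover have "((\<lambda>t. exp (t * ln c + (1 - t) * ln d)) has_real_derivative
      (ln c - ln d) * exp (t * ln c + (1 - t) * ln d)) (at t within S)"
    by (auto intro!: derivative_eq_intros)
  ultimately show ?thesis by (simp only: fun_eq_iff)
qed

section \<open>Estimates from GA-convexity\<close>

text \<open>Substituting the geometric path produces the Jacobian
  \<open>\<bar>ln c - ln d\<bar> * x t\<close>. Its constant part is pulled out, its factor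
  \<open>x t\<close> is joined to \<open>\<bar>F (x t)\<bar>\<close>, and the power mean inequality
  is applied with weight \<open>\<bar>w (x t)\<bar>\<close>. The endpoints are unordered so that one
  statement serves both sides of the geometric mean.\<close>

lemma GA_convex_segment_integral_le:
  fixes F w :: "real \<Rightarrow> real" and c d q :: real
  assumes q: "q > 1" and cd: "c \<noteq> d" "c \<in> J" "d \<in> J"
    and GA: "GA_convex_on J (\<lambda>x. \<bar>F x\<bar> powr q)"
    and w: "continuous_on (closed_segment c d) w"
    and wF: "(\<lambda>x. w x * F x) absolutely_integrable_on closed_segment c d"
  shows "\<bar>integral (closed_segment c d) (\<lambda>x. w x * F x)\<bar> \<le> \<bar>ln c - ln d\<bar> *
     ((integral {0..1} (\<lambda>t. \<bar>w (c powr t * d powr (1 - t))\<bar>)) powr (1 - 1 / q)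
        * (integral {0..1} (\<lambda>t. \<bar>w (c powr t * d powr (1 - t))\<bar>
            * (t * c powr (q * t) * d powr (q * (1 - t)) * \<bar>F c\<bar> powr q
               + (1 - t) * c powr (q * t) * d powr (q * (1 - t)) * \<bar>F d\<bar> powr q))) powr (1 / q))"
proof -
  define x where "x t = c powr t * d powr (1 - t)" for t
  define V where "V t = t * c powr (q * t) * d powr (q * (1 - t)) * \<bar>F c\<bar> powr q
               + (1 - t) * c powr (q * t) * d powr (q * (1 - t)) * \<bar>F d\<bar> powr q" for t
  have pos: "c > 0" "d > 0" using GA cd unfolding GA_convex_on_def by auto
  have x0: "x t > 0" for t using pos by (simp add: x_def)
  have img: "x ` {0..1} = closed_segment c d"
    unfolding x_def using pos cd by (intro geometric_path_image)
  have der: "(x has_field_derivative (ln c - ln d) * x t) (at t within {0..1})" for t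
    unfolding x_def using pos by (rule geometric_path_has_derivative)
  have inj: "inj_on x {0..1}"
    unfolding x_def using geometric_path_inj[OF pos] cd inj_on_subset by blast
  have contx: "continuous_on {0..1} x"
    using der DERIV_continuous continuous_on_eq_continuous_within by blast
  have meas: "{0..1::real} \<in> sets lebesgue" by simp
  have subst: "(\<lambda>t. \<bar>(ln c - ln d) * x t\<bar> * (w (x t) * F (x t))) absolutely_integrable_on {0..1}"
    "integral {0..1} (\<lambda>t. \<bar>(ln c - ln d) * x t\<bar> * (w (x t) * F (x t)))
      = integral (closed_segment c d) (\<lambda>x. w x * F x)"
    using iffD2[OF has_absolute_integral_change_of_variables_1'[OF meas der inj], OF conjI,
        of "\<lambda>x. w x * F x", unfolded img, OF wF refl] by (rule conjunct1, rule conjunct2)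
  have L: "\<bar>ln c - ln d\<bar> > 0" using pos cd by simp
  have ai: "(\<lambda>t. \<bar>ln c - ln d\<bar> * (\<bar>w (x t)\<bar> * (x t * \<bar>F (x t)\<bar>))) integrable_on {0..1}"
    using absolutely_integrable_norm[OF subst(1)] x0
    by (simp add: abs_mult mult_ac abs_of_pos absolutely_integrable_on_def)
  have wvi: "(\<lambda>t. \<bar>w (x t)\<bar> * (x t * \<bar>F (x t)\<bar>)) integrable_on {0..1}"
    using integrable_on_cmult_left[OF ai, of "1 / \<bar>ln c - ln d\<bar>"] L by simp
  have cw: "continuous_on {0..1} (\<lambda>t. \<bar>w (x t)\<bar>)"
    using contx w img by (intro continuous_on_rabs continuous_on_compose2[OF w]) auto
  have "continuous_on {0..1} V"
    unfolding V_def using pos by (intro continuous_intros) auto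
  then have wVi: "(\<lambda>t. \<bar>w (x t)\<bar> * V t) integrable_on {0..1}"
    using cw by (intro integrable_continuous_real continuous_on_mult)
  \<comment> \<open>GA-convexity bounds \<open>\<bar>F (x t)\<bar> powr q\<close>; the powers of
    \<open>c\<close> and \<open>d\<close> in \<open>V\<close> come from raising the Jacobian factor
    \<open>x t\<close> to the power \<open>q\<close>.\<close>
  have le: "(x t * \<bar>F (x t)\<bar>) powr q \<le> V t" if t: "t \<in> {0..1}" for t
  proof -
    have "\<bar>F (x t)\<bar> powr q \<le> t * \<bar>F c\<bar> powr q + (1 - t) * \<bar>F d\<bar> powr q"
      using GA cd t unfolding GA_convex_on_def x_def by blast
    then have "x t powr q * \<bar>F (x t)\<bar> powr q
        \<le> x t powr q * (t * \<bar>F c\<bar> powr q + (1 - t) * \<bar>F d\<bar> powr q)"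
      by (intro mult_left_mono) auto
    moreover have "x t powr q = c powr (q * t) * d powr (q * (1 - t))"
      using pos by (simp add: x_def powr_mult powr_powr mult.commute)
    ultimately show ?thesis
      using x0[of t] by (simp add: V_def powr_mult algebra_simps)
  qed
  have "\<bar>integral (closed_segment c d) (\<lambda>x. w x * F x)\<bar>
      \<le> integral {0..1} (\<lambda>t. \<bar>ln c - ln d\<bar> * (\<bar>w (x t)\<bar> * (x t * \<bar>F (x t)\<bar>)))"
    unfolding subst(2)[symmetric]
    by (rule integral_norm_bound_integral[OF set_lebesgue_integral_eq_integral(1)[OF subst(1)] ai,
          unfolded real_norm_def])
      (simp add: abs_mult abs_of_pos x0)
  also have "\<dots> = \<bar>ln c - ln d\<bar> * integral {0..1} (\<lambda>t. \<bar>w (x t)\<bar> * (x t * \<bar>F (x t)\<bar>))"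
    by simp
  also have "\<dots> \<le> \<bar>ln c - ln d\<bar> * (integral {0..1} (\<lambda>t. \<bar>w (x t)\<bar>) powr (1 - 1 / q)
      * integral {0..1} (\<lambda>t. \<bar>w (x t)\<bar> * V t) powr (1 / q))"
    using q cw wvi wVi le less_imp_le[OF x0]
    by (intro mult_left_mono integral_power_mean_le) auto
  finally show ?thesis by (simp add: x_def V_def)
qed

text \<open>Every point of the interval is a weighted geometric mean of \<open>a\<close> and
  \<open>b\<close>, so its value is at most a convex combination of the endpoint values.\<close>

lemma GA_convex_on_bounded:
  fixes a b :: real
  assumes "GA_convex_on {a..b} \<phi>" and "a < b" and "x \<in> {a..b}"
  shows "\<phi> x \<le> max (\<phi> a) (\<phi> b)"
proof -
  have "a \<in> {a..b}" using \<open>a < b\<close> by simp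
  then have pos: "a > 0" using assms(1) unfolding GA_convex_on_def by blast
  have "x \<in> (\<lambda>t. a powr t * b powr (1 - t)) ` {0..1}"
    using geometric_path_image[of a b] pos assms by (simp add: closed_segment_eq_real_ivl)
  then obtain t where t: "t \<in> {0..1}" "x = a powr t * b powr (1 - t)" by blast
  then have "\<phi> x \<le> t * \<phi> a + (1 - t) * \<phi> b"
    using assms unfolding GA_convex_on_def by auto
  also have "\<dots> \<le> t * max (\<phi> a) (\<phi> b) + (1 - t) * max (\<phi> a) (\<phi> b)"
    using t by (intro add_mono mult_left_mono) auto
  finally show ?thesis by (simp add: algebra_simps)
qed

section \<open>Integration by parts and splitting at the geometric mean\<close>

theorem theorem6:
  fixes I :: "real set" and f f' g h h' :: "real \<Rightarrow> real" and a b p q G :: real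
  assumes "is_interval I" and "I \<subseteq> {0<..}"
    and "\<And>x. x \<in> interior I \<Longrightarrow> (f has_real_derivative f' x) (at x)"
    and "a \<in> I" and "b \<in> I" and "a < b"
    and "(f has_real_derivative f' a) (at a within I)"
    and "(f has_real_derivative f' b) (at b within I)"
    and "continuous_on {a..b} g" and "\<And>x. x \<in> {a..b} \<Longrightarrow> g x > 0"
    and "geometrically_symmetric a b g"
    and "\<And>x. x \<in> {a..b} \<Longrightarrow> h x \<ge> 0"
    and "\<And>x. x \<in> {a..b} \<Longrightarrow> (h has_real_derivative h' x) (at x within {a..b})"
    and "p > 1" and "q > 1" and "1 / q + 1 / p = 1"
    and "G = sqrt (a * b)"
    and "GA_convex_on {a..b} (\<lambda>x. \<bar>f' x\<bar> powr q)"
  shows "\<bar>(h b - 2 * h a) * (f a / 2) + h b * (f b / 2) - integral {a..b} (\<lambda>x. f x * h' x)\<bar>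
    \<le> (ln b - ln a) / 4 *
      ((integral {0..1} (\<lambda>t. \<bar>2 * h (a powr t * G powr (1 - t)) - h b\<bar>)) powr (1 - 1 / q)
        * (integral {0..1} (\<lambda>t. \<bar>2 * h (a powr t * G powr (1 - t)) - h b\<bar>
            * (t * a powr (q * t) * G powr (q * (1 - t)) * \<bar>f' a\<bar> powr q
               + (1 - t) * a powr (q * t) * G powr (q * (1 - t)) * \<bar>f' G\<bar> powr q))) powr (1 / q)
       + (integral {0..1} (\<lambda>t. \<bar>2 * h (b powr t * G powr (1 - t)) - h b\<bar>)) powr (1 - 1 / q)
        * (integral {0..1} (\<lambda>t. \<bar>2 * h (b powr t * G powr (1 - t)) - h b\<bar>
            * (t * b powr (q * t) * G powr (q * (1 - t)) * \<bar>f' b\<bar> powr q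
               + (1 - t) * b powr (q * t) * G powr (q * (1 - t)) * \<bar>f' G\<bar> powr q))) powr (1 / q))"
proof -
  \<comment> \<open>This weight gives \<open>w b = h b\<close> and
    \<open>w a = 2 * h a - h b\<close>, so \<open>w b * f b - w a * f a\<close> is twice the
    boundary part of the claim, and its derivative is \<open>2 * h' x\<close>.\<close>
  define w where "w x = 2 * h x - h b" for x
  have pos: "a > 0" using assms by auto
  have G: "a < G" "G < b"
  proof -
    have "a\<^sup>2 < a * b" "a * b < b\<^sup>2"
      using pos \<open>a < b\<close> by (simp_all add: power2_eq_square)
    then show "a < G" "G < b"
      unfolding \<open>G = sqrt (a * b)\<close>
      using pos \<open>a < b\<close> real_less_rsqrt[of a "a * b"] real_less_lsqrt[of b "a * b"] by simp_all
  qed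
  have lnG: "ln G = (ln a + ln b) / 2"
    using pos \<open>a < b\<close> \<open>G = sqrt (a * b)\<close> by (simp add: ln_sqrt ln_mult)
  have sub: "{a..b} \<subseteq> I"
    using assms(1,4,5) unfolding is_interval_1 atLeastAtMost_iff subset_iff by blast
  \<comment> \<open>The endpoints may lie on the boundary of \<open>I\<close>, where only the
    derivative within \<open>I\<close> is given; all other points of \<open>{a..b}\<close> are
    interior to \<open>I\<close>.\<close>
  have df: "(f has_real_derivative f' x) (at x within {a..b})" if x: "x \<in> {a..b}" for x
  proof -
    consider "x = a" | "x = b" | "x \<in> {a<..<b}" using x by force
    then show ?thesis
    proof cases
      case 1
      with assms(7) sub show ?thesis by (blast intro: DERIV_subset)
    next
      case 2
      with assms(8) sub show ?thesis by (blast intro: DERIV_subset)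
    next
      case 3
      have "{a<..<b} \<subseteq> interior I"
        using sub by (intro interior_maximal) auto
      with 3 have "(f has_real_derivative f' x) (at x)" by (intro assms(3)) auto
      then show ?thesis by (rule has_field_derivative_at_within)
    qed
  qed
  have dw: "(w has_real_derivative 2 * h' x) (at x within {a..b})" if "x \<in> {a..b}" for x
    unfolding w_def using assms(13)[OF that] by (auto intro!: derivative_eq_intros)
  have cw: "continuous_on {a..b} w"
    using dw DERIV_continuous continuous_on_eq_continuous_within by blast
  have wf': "(\<lambda>x. w x * f' x) absolutely_integrable_on {a..b}"
  proof (rule absolutely_integrable_bounded_measurable_product_real)
    show "w \<in> borel_measurable (lebesgue_on {a..b})"
      using cw by (intro continuous_imp_measurable_on_sets_lebesgue) auto
    show "bounded (w ` {a..b})"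
      using cw by (intro compact_imp_bounded compact_continuous_image) auto
    \<comment> \<open>A derivative is Henstock-Kurzweil integrable but perhaps not absolutely so;
      the constant bound obtained next from GA-convexity closes this gap.\<close>
    have "(f' has_integral (f b - f a)) {a..b}"
      using df \<open>a < b\<close>
      by (intro fundamental_theorem_of_calculus) (auto simp: has_real_derivative_iff_has_vector_derivative)
    moreover have "norm (f' x) \<le> max (\<bar>f' a\<bar> powr q) (\<bar>f' b\<bar> powr q) powr (1 / q)"
      if "x \<in> {a..b}" for x
    proof -
      have "(\<bar>f' x\<bar> powr q) powr (1 / q) \<le> max (\<bar>f' a\<bar> powr q) (\<bar>f' b\<bar> powr q) powr (1 / q)"
        using GA_convex_on_bounded[OF assms(18) \<open>a < b\<close> that] \<open>q > 1\<close>
        by (intro powr_mono2) auto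
      then show ?thesis using \<open>q > 1\<close> by (simp add: powr_powr)
    qed
    ultimately show "f' absolutely_integrable_on {a..b}"
      by (intro absolutely_integrable_integrable_bound[where
            g = "\<lambda>x. max (\<bar>f' a\<bar> powr q) (\<bar>f' b\<bar> powr q) powr (1 / q)"]) auto
  qed auto
  have int: "(\<lambda>x. w x * f' x) integrable_on {a..b}"
    using wf' by (simp add: absolutely_integrable_on_def)
  \<comment> \<open>The product rule makes the whole sum integrable; subtracting the integrable
    \<open>w x * f' x\<close> then yields both integrability and value for the term with
    \<open>h'\<close>.\<close>
  have "((\<lambda>x. w x * f' x + 2 * h' x * f x) has_integral (w b * f b - w a * f a)) {a..b}"
    using df dw \<open>a < b\<close>
    by (intro fundamental_theorem_of_calculus)
      (auto simp: has_real_derivative_iff_has_vector_derivative[symmetric] intro!: derivative_eq_intros)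
  from has_integral_diff[OF this integrable_integral[OF int]]
  have "((\<lambda>x. 2 * h' x * f x) has_integral
      w b * f b - w a * f a - integral {a..b} (\<lambda>x. w x * f' x)) {a..b}"
    by simp
  from has_integral_mult_right[OF this, of "1 / 2"]
  have fh': "integral {a..b} (\<lambda>x. f x * h' x)
      = (w b * f b - w a * f a - integral {a..b} (\<lambda>x. w x * f' x)) / 2"
    by (intro integral_unique) (simp add: mult_ac)
  have "(h b - 2 * h a) * (f a / 2) + h b * (f b / 2) - integral {a..b} (\<lambda>x. f x * h' x)
      = integral {a..b} (\<lambda>x. w x * f' x) / 2"
    unfolding fh' by (simp add: w_def field_simps)
  also have "integral {a..b} (\<lambda>x. w x * f' x)
      = integral {a..G} (\<lambda>x. w x * f' x) + integral {G..b} (\<lambda>x. w x * f' x)"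
    using G Henstock_Kurzweil_Integration.integral_combine[OF _ _ int, of G] by simp
  finally have eq: "(h b - 2 * h a) * (f a / 2) + h b * (f b / 2) - integral {a..b} (\<lambda>x. f x * h' x)
      = (integral {a..G} (\<lambda>x. w x * f' x) + integral {G..b} (\<lambda>x. w x * f' x)) / 2" .
  have split: "\<bar>(h b - 2 * h a) * (f a / 2) + h b * (f b / 2) - integral {a..b} (\<lambda>x. f x * h' x)\<bar>
      \<le> (\<bar>integral (closed_segment a G) (\<lambda>x. w x * f' x)\<bar>
        + \<bar>integral (closed_segment b G) (\<lambda>x. w x * f' x)\<bar>) / 2"
    unfolding eq using G abs_triangle_ineq by (simp add: closed_segment_eq_real_ivl)
  \<comment> \<open>Both paths have \<open>G\<close> at \<open>t = 0\<close> and the outer endpoint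
    at \<open>t = 1\<close>, as in the claimed bound; the absolute value hides their opposite
    orientations.\<close>
  have half: "\<bar>integral (closed_segment c G) (\<lambda>x. w x * f' x)\<bar> \<le> \<bar>ln c - ln G\<bar> *
     ((integral {0..1} (\<lambda>t. \<bar>w (c powr t * G powr (1 - t))\<bar>)) powr (1 - 1 / q)
        * (integral {0..1} (\<lambda>t. \<bar>w (c powr t * G powr (1 - t))\<bar>
            * (t * c powr (q * t) * G powr (q * (1 - t)) * \<bar>f' c\<bar> powr q
               + (1 - t) * c powr (q * t) * G powr (q * (1 - t)) * \<bar>f' G\<bar> powr q))) powr (1 / q))"
    if "c \<in> {a, b}" for c
  proof (rule GA_convex_segment_integral_le[OF \<open>q > 1\<close> _ _ _ assms(18)])
    have seg: "closed_segment c G \<subseteq> {a..b}"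
      using that G by (auto simp: closed_segment_eq_real_ivl)
    show "continuous_on (closed_segment c G) w"
      using cw seg by (rule continuous_on_subset)
    show "(\<lambda>x. w x * f' x) absolutely_integrable_on closed_segment c G"
      by (rule set_integrable_subset[OF wf' _ seg]) (simp add: closed_segment_eq_real_ivl)
  qed (use that G in auto)
  \<comment> \<open>\<open>ln G\<close> is the midpoint of \<open>ln a\<close> and
    \<open>ln b\<close>. The resulting factor 1/2 and the one from integrating by parts make up the
    constant 1/4.\<close>
  have ln_diff: "\<bar>ln a - ln G\<bar> = (ln b - ln a) / 2" "\<bar>ln b - ln G\<bar> = (ln b - ln a) / 2"
    using pos \<open>a < b\<close> by (auto simp: lnG field_simps)
  have combine: "X \<le> D / 4 * (R1 + R2)"
    if "X \<le> (J1 + J2) / 2" "J1 \<le> D / 2 * R1" "J2 \<le> D / 2 * R2" for X J1 J2 D R1 R2 :: real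
    using that by (simp add: algebra_simps)
  show ?thesis
    by (rule combine[OF split half[of a, unfolded ln_diff] half[of b, unfolded ln_diff],
          unfolded w_def]) simp_all
qed

end
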